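(* The LP relaxations of the two mixed integer linear programs (MILP) and (RF) described in the context are equivalent; that is, one of these two LP relaxations is feasible if and only if the other is, and, whenever either of them has an optimal solution, they share at least one identical optimal solution $(x,v,z)$ (and hence have the same optimal value).
   Context: Notation: $[n]=\{1,\dots,n\}$; inequalities between vectors are componentwise. Data: a polyhedron $\mathcal{X}\subseteq\mathbb{R}^d$, an $m\times d$ real matrix $T$, a cost vector $c\in\mathbb{R}^d$, vectors $\xi^1,\dots,\xi^n\in\mathbb{R}^m$ with $\xi^i\ge 0$, probabilities $p_i\ge0$ with $\sum_{i=1}^n p_i=1$, and $\epsilon\in(0,1)$. (MILP) is: minimize $c^\top x$ over $(x,v,z)$ subject to $Tx=v$, $x\in\mathcal{X}$; $v\ge \xi^i(1-z_i)$ for all $i\in[n]$; $\sum_{i=1}^n p_iz_i\le\epsilon$; $v\in\mathbb{R}^m_+$, $z\in\{0,1\}^n$. (RF) is (MILP) with the additional dominance inequalities $z_i\le z_j$ for all $(i,j)\in\mathcal{A}:=\{(i,j)\in[n]\times[n]: \xi^i\le\xi^j,\ i\ne j\}$. The LP relaxation of each problem is obtained by replacing $z\in\{0,1\}^n$ with $z\in[0,1]^n$. *)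

theory Defs
  imports "HOL-Analysis.Analysis"
begin

text \<open>
  The scenarios are indexed by a finite type \<open>'n\<close> in place of \<open>[n]\<close>; the order on vectors is
  the componentwise one. The parameter \<open>Z\<close> of the feasible regions is the domain of each \<open>z\<^sub>i\<close>:
  \<open>Z = {0, 1}\<close> gives the mixed integer programs, \<open>Z = {0..1}\<close> their LP relaxations.
\<close>

definition MILP_region ::
  "real set \<Rightarrow> (real^'d) set \<Rightarrow> real^'d^'m \<Rightarrow> ('n::finite \<Rightarrow> real^'m) \<Rightarrow> ('n \<Rightarrow> real) \<Rightarrow> real
    \<Rightarrow> ((real^'d) \<times> (real^'m) \<times> (real^'n)) set" where
  "MILP_region Z X T \<xi> p \<epsilon> =
    {(x, v, z). T *v x = v \<and> x \<in> X \<and> (\<forall>i. v \<ge> (1 - z $ i) *\<^sub>R \<xi> i)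
       \<and> (\<Sum>i\<in>UNIV. p i * z $ i) \<le> \<epsilon> \<and> v \<ge> 0 \<and> (\<forall>i. z $ i \<in> Z)}"

definition dominance_pairs :: "('n \<Rightarrow> real^'m) \<Rightarrow> ('n \<times> 'n) set" where
  "dominance_pairs \<xi> = {(i, j). \<xi> i \<le> \<xi> j \<and> i \<noteq> j}"

definition RF_region ::
  "real set \<Rightarrow> (real^'d) set \<Rightarrow> real^'d^'m \<Rightarrow> ('n::finite \<Rightarrow> real^'m) \<Rightarrow> ('n \<Rightarrow> real) \<Rightarrow> real
    \<Rightarrow> ((real^'d) \<times> (real^'m) \<times> (real^'n)) set" where
  "RF_region Z X T \<xi> p \<epsilon> =
    {(x, v, z). (x, v, z) \<in> MILP_region Z X T \<xi> p \<epsilon>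
       \<and> (\<forall>(i, j) \<in> dominance_pairs \<xi>. z $ i \<le> z $ j)}"

abbreviation MILP :: "(real^'d) set \<Rightarrow> real^'d^'m \<Rightarrow> ('n::finite \<Rightarrow> real^'m) \<Rightarrow> ('n \<Rightarrow> real) \<Rightarrow> real
    \<Rightarrow> ((real^'d) \<times> (real^'m) \<times> (real^'n)) set" where
  "MILP \<equiv> MILP_region {0, 1}"

abbreviation RF :: "(real^'d) set \<Rightarrow> real^'d^'m \<Rightarrow> ('n::finite \<Rightarrow> real^'m) \<Rightarrow> ('n \<Rightarrow> real) \<Rightarrow> real
    \<Rightarrow> ((real^'d) \<times> (real^'m) \<times> (real^'n)) set" where
  "RF \<equiv> RF_region {0, 1}"

abbreviation MILP_LP :: "(real^'d) set \<Rightarrow> real^'d^'m \<Rightarrow> ('n::finite \<Rightarrow> real^'m) \<Rightarrow> ('n \<Rightarrow> real) \<Rightarrow> real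
    \<Rightarrow> ((real^'d) \<times> (real^'m) \<times> (real^'n)) set" where
  "MILP_LP \<equiv> MILP_region {0..1}"

abbreviation RF_LP :: "(real^'d) set \<Rightarrow> real^'d^'m \<Rightarrow> ('n::finite \<Rightarrow> real^'m) \<Rightarrow> ('n \<Rightarrow> real) \<Rightarrow> real
    \<Rightarrow> ((real^'d) \<times> (real^'m) \<times> (real^'n)) set" where
  "RF_LP \<equiv> RF_region {0..1}"

definition objective :: "real^'d \<Rightarrow> (real^'d) \<times> (real^'m) \<times> (real^'n) \<Rightarrow> real" where
  "objective c = (\<lambda>(x, v, z). c \<bullet> x)"

definition optimal_solution ::
  "real^'d \<Rightarrow> ((real^'d) \<times> (real^'m) \<times> (real^'n)) set \<Rightarrow> (real^'d) \<times> (real^'m) \<times> (real^'n) \<Rightarrow> bool" where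
  "optimal_solution c F s \<longleftrightarrow> is_arg_min (objective c) (\<lambda>s. s \<in> F) s"

text \<open>
  The infimum is taken in \<open>real\<close>, so this is only meaningful for a nonempty region on which the
  objective is bounded below, in particular when an optimal solution exists.
\<close>

definition optimal_value :: "real^'d \<Rightarrow> ((real^'d) \<times> (real^'m) \<times> (real^'n)) set \<Rightarrow> real" where
  "optimal_value c F = (INF s\<in>F. objective c s)"

end

theory Submission
  imports Defs
begin

text \<open>
  Replacing each \<open>z\<^sub>i\<close> by the minimum of \<open>z\<^sub>j\<close> over all scenarios \<open>j\<close> with \<open>\<xi>\<^sup>i \<le> \<xi>\<^sup>j\<close> turns a
  feasible point of the first relaxation into one that satisfies the dominance inequalities. Since
  \<open>z\<close> only decreases, the knapsack constraint survives; and if the minimum is attained at \<open>j\<close>, then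
  \<open>v \<ge> (1 - z\<^sub>j) \<xi>\<^sup>j \<ge> (1 - z\<^sub>j) \<xi>\<^sup>i\<close>. Both \<open>x\<close> and \<open>v\<close>, hence the cost, are unchanged.
\<close>

text \<open>Unlike in \<open>dominance_pairs\<close>, \<open>j = i\<close> is allowed, so the
  minimum is over a nonempty set and is at most \<open>z $ i\<close>.\<close>

definition dominance_min :: "('n::finite \<Rightarrow> real^'m) \<Rightarrow> real^'n \<Rightarrow> real^'n" where
  "dominance_min \<xi> z = (\<chi> i. MIN j\<in>{j. \<xi> i \<le> \<xi> j}. z $ j)"

lemma dominance_min_le:
  assumes "\<xi> i \<le> \<xi> j"
  shows "dominance_min \<xi> z $ i \<le> z $ j"
  using assms by (simp add: dominance_min_def)

lemma dominance_min_attained: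
  obtains j where "\<xi> i \<le> \<xi> j" "dominance_min \<xi> z $ i = z $ j"
proof -
  have "(MIN j\<in>{j. \<xi> i \<le> \<xi> j}. z $ j) \<in> (\<lambda>j. z $ j) ` {j. \<xi> i \<le> \<xi> j}"
    by (rule Min_in) auto
  then show thesis
    using that by (auto simp: dominance_min_def)
qed

lemma dominance_min_mono:
  assumes "\<xi> i \<le> \<xi> j"
  shows "dominance_min \<xi> z $ i \<le> dominance_min \<xi> z $ j"
proof -
  obtain k where "\<xi> j \<le> \<xi> k" "dominance_min \<xi> z $ j = z $ k"
    by (rule dominance_min_attained)
  \<comment> \<open>By transitivity \<open>k\<close> also competes in the minimum for
    \<open>i\<close>.\<close>
  with assms show ?thesis
    by (simp add: dominance_min_le)
qed

text \<open>Each new entry is an attained minimum, hence an old entry of \<open>z\<close>, so it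
  stays in \<open>Z\<close> whether \<open>Z\<close> is an interval or
  \<open>{0, 1}\<close>.\<close>

lemma dominance_min_in_RF_region:
  assumes mem: "(x, v, z) \<in> MILP_region Z X T \<xi> p \<epsilon>"
    and "Z \<subseteq> {..1}" and "\<And>i. p i \<ge> 0"
  shows "(x, v, dominance_min \<xi> z) \<in> RF_region Z X T \<xi> p \<epsilon>"
proof -
  let ?z = "dominance_min \<xi> z"
  have z: "z $ i \<in> Z" and v: "(1 - z $ i) *\<^sub>R \<xi> i \<le> v" for i
    using mem by (auto simp: MILP_region_def)
  have "(1 - ?z $ i) *\<^sub>R \<xi> i \<le> v \<and> ?z $ i \<in> Z" for i
  proof -
    obtain j where j: "\<xi> i \<le> \<xi> j" "?z $ i = z $ j"
      by (rule dominance_min_attained)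
    \<comment> \<open>The bound \<open>Z \<subseteq> {..1}\<close> makes the factor nonnegative, so
      scaling preserves the order.\<close>
    have "(1 - z $ j) *\<^sub>R \<xi> i \<le> (1 - z $ j) *\<^sub>R \<xi> j"
      using j(1) z[of j] assms(2) by (intro scaleR_left_mono) auto
    with v[of j] z[of j] j(2) show ?thesis
      by auto
  qed
  moreover have "(\<Sum>i\<in>UNIV. p i * ?z $ i) \<le> (\<Sum>i\<in>UNIV. p i * z $ i)"
    by (intro sum_mono mult_left_mono assms(3) dominance_min_le order_refl)
  ultimately show ?thesis
    using mem by (auto simp: RF_region_def MILP_region_def dominance_pairs_def
        intro: dominance_min_mono)
qed

lemma RF_region_subset_MILP_region: "RF_region Z X T \<xi> p \<epsilon> \<subseteq> MILP_region Z X T \<xi> p \<epsilon>"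
  by (auto simp: RF_region_def)

text \<open>Passing to \<open>dominance_min\<close> keeps \<open>x\<close> and hence the cost.
  Nonemptiness, the infimum and the existence of a minimizer depend on a region only through this
  set of costs.\<close>

lemma objective_image_RF_region:
  assumes "Z \<subseteq> {..1}" and "\<And>i. p i \<ge> 0"
  shows "objective c ` MILP_region Z X T \<xi> p \<epsilon> = objective c ` RF_region Z X T \<xi> p \<epsilon>"
proof
  show "objective c ` MILP_region Z X T \<xi> p \<epsilon> \<subseteq> objective c ` RF_region Z X T \<xi> p \<epsilon>"
  proof (rule image_subsetI)
    fix s assume "s \<in> MILP_region Z X T \<xi> p \<epsilon>"
    moreover obtain x v z where s: "s = (x, v, z)"
      by (rule prod_cases3)
    ultimately have "(x, v, dominance_min \<xi> z) \<in> RF_region Z X T \<xi> p \<epsilon>"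
      using assms by (blast intro: dominance_min_in_RF_region)
    then show "objective c s \<in> objective c ` RF_region Z X T \<xi> p \<epsilon>"
      by (rule rev_image_eqI) (simp add: s objective_def)
  qed
qed (intro image_mono RF_region_subset_MILP_region)

lemma optimal_solution_iff:
  "optimal_solution c F s \<longleftrightarrow> s \<in> F \<and> (\<forall>y \<in> objective c ` F. objective c s \<le> y)"
  by (auto simp: optimal_solution_def is_arg_min_linorder)

text \<open>With equal cost sets, the least cost over \<open>G\<close> is also the least over
  \<open>F\<close>.\<close>

lemma optimal_solution_subset:
  assumes "G \<subseteq> F" and "objective c ` F = objective c ` G"
  shows "optimal_solution c G s \<longleftrightarrow> optimal_solution c F s \<and> s \<in> G"
  using assms by (auto simp: optimal_solution_iff)

lemma optimal_solution_same_objective_image: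
  assumes "optimal_solution c F s" and "objective c ` F = objective c ` G"
  obtains t where "optimal_solution c G t"
proof -
  from assms have "objective c s \<in> objective c ` G"
    by (auto simp: optimal_solution_iff)
  then obtain t where "t \<in> G" "objective c s = objective c t"
    by (rule imageE)
  with assms have "optimal_solution c G t"
    by (simp add: optimal_solution_iff)
  then show thesis
    by (rule that)
qed

theorem proposition3p3:
  fixes X :: "(real^'d) set" and T :: "real^'d^'m" and c :: "real^'d"
    and \<xi> :: "'n::finite \<Rightarrow> real^'m" and p :: "'n \<Rightarrow> real" and \<epsilon> :: real
  assumes "polyhedron X"
    and "\<And>i. \<xi> i \<ge> 0"
    and "\<And>i. p i \<ge> 0"
    and "(\<Sum>i\<in>UNIV. p i) = 1"
    and "\<epsilon> \<in> {0<..<1}"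
  shows "(MILP_LP X T \<xi> p \<epsilon> \<noteq> {} \<longleftrightarrow> RF_LP X T \<xi> p \<epsilon> \<noteq> {})
    \<and> ((\<exists>s. optimal_solution c (MILP_LP X T \<xi> p \<epsilon>) s) \<or> (\<exists>s. optimal_solution c (RF_LP X T \<xi> p \<epsilon>) s)
       \<longrightarrow> (\<exists>x v z. optimal_solution c (MILP_LP X T \<xi> p \<epsilon>) (x, v, z)
                   \<and> optimal_solution c (RF_LP X T \<xi> p \<epsilon>) (x, v, z))
           \<and> optimal_value c (MILP_LP X T \<xi> p \<epsilon>) = optimal_value c (RF_LP X T \<xi> p \<epsilon>))"
proof -
  let ?F = "MILP_LP X T \<xi> p \<epsilon>" and ?G = "RF_LP X T \<xi> p \<epsilon>"
  have img: "objective c ` ?F = objective c ` ?G"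
    using assms(3) by (intro objective_image_RF_region) auto
  then have "?F \<noteq> {} \<longleftrightarrow> ?G \<noteq> {}"
    by blast
  moreover have "optimal_value c ?F = optimal_value c ?G"
    by (simp add: optimal_value_def img)
  moreover have "\<exists>x v z. optimal_solution c ?F (x, v, z) \<and> optimal_solution c ?G (x, v, z)"
    if "(\<exists>s. optimal_solution c ?F s) \<or> (\<exists>s. optimal_solution c ?G s)"
  proof -
    \<comment> \<open>The shared solution is sought in the smaller region, because its points are
      feasible for both problems.\<close>
    from that obtain t where "optimal_solution c ?G t"
      using optimal_solution_same_objective_image[OF _ img] by blast
    moreover obtain x v z where "t = (x, v, z)"
      by (rule prod_cases3)
    ultimately show ?thesis
      using optimal_solution_subset[OF RF_region_subset_MILP_region img] by blast
  qed
  ultimately show ?thesis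
    by blast
qed

end
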